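(* Let $L$ be a lattice with $(q-1)L_\beta\subseteq L\subseteq L_\beta$. Then $I(V_{X(\mathbb K)}(I_L))=I_L$ for any field $\mathbb K$ which is an extension of $\mathbb F_q$.
   Context: $\mathbb F_q$ is a finite field, $\mathbb K$ is an extension field of $\mathbb F_q$ with algebraic closure $\overline{\mathbb K}$. $\Sigma$ is a complete simplicial fan in $\mathbb R^n$ with rays $\rho_1,\dots,\rho_r$ generated by primitive lattice vectors $\mathbf v_1,\dots,\mathbf v_r\in\mathbb Z^n$, and $X=X_\Sigma$ is the corresponding split toric variety over $\mathbb F_q$; its class group $\operatorname{Cl}X$ is assumed to be free. Let $\phi:\mathbb Z^n\to\mathbb Z^r$ be the $r\times n$ matrix with rows $\mathbf v_1,\dots,\mathbf v_r$, let $d=r-n$, and let $\beta:\mathbb Z^r\to\mathbb Z^d\cong \operatorname{Cl}X$ be an integer matrix such that $0\to\mathbb Z^n\xrightarrow{\phi}\mathbb Z^r\xrightarrow{\beta}\mathbb Z^d\to0$ is exact. $L_\beta=\operatorname{im}\phi=\ker\beta\subseteq\mathbb Z^r$, a lattice of rank $n$. The Cox ring $S=\mathbb F_q[x_1,\dots,x_r]$ is graded by $\deg x_j=\beta_j$, the $j$-th column of $\beta$; "homogeneous" refers to this grading. For a sublattice $L\subseteq L_\beta$, the lattice ideal is $I_L=\langle \mathbf x^{\mathbf m^+}-\mathbf x^{\mathbf m^-} : \mathbf m=\mathbf m^+-\mathbf m^-\in L\rangle\subseteq S$, where $\mathbf m^{\pm}\in\mathbb N^r$ are the positive and negative parts of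 $\mathbf m$. $B\subseteq S$ is the monomial ideal generated by $\prod_{\rho_i\not\subseteq\sigma}x_i$, $\sigma\in\Sigma$. $G=\{P\in(\overline{\mathbb K}^* )^r : \mathbf x^{\mathbf m}(P)=1 \text{ for all } \mathbf m\in L_\beta\}$, where $\mathbf x^{\mathbf a}(P)=p_1^{a_1}\cdots p_r^{a_r}$. $X(\mathbb K)$ is the set of orbits $[P]=G\cdot P$ with $P\in\mathbb K^r\setminus V(B)$. For a homogeneous ideal $J\subseteq S$, $V_{X(\mathbb K)}(J)=\{[P]\in X(\mathbb K): F(P)=0\text{ for all homogeneous }F\in J\}$. For $Y\subseteq X(\mathbb K)$, the vanishing ideal $I(Y)\subseteq S=\mathbb F_q[x_1,\dots,x_r]$ is the ideal generated by the homogeneous polynomials in $S$ vanishing at all points of $Y$. *)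

theory Defs
  imports
    "HOL-Analysis.Analysis"
    "HOL-Library.Poly_Mapping"
    "HOL-Algebra.Algebraic_Closure_Type"
begin

section \<open>Fans in \<open>\<real>\<^sup>n\<close>\<close>

definition real_vec :: "int ^ 'n \<Rightarrow> real ^ 'n" where
  "real_vec u = (\<chi> j. of_int (u $ j))"

definition rational_polyhedral_cone :: "(real ^ 'n) set \<Rightarrow> bool" where
  "rational_polyhedral_cone \<sigma> \<longleftrightarrow>
     (\<exists>A :: (int ^ 'n) set. finite A \<and> \<sigma> = convex_cone hull (real_vec ` A))"

definition strongly_convex :: "(real ^ 'n) set \<Rightarrow> bool" where
  "strongly_convex \<sigma> \<longleftrightarrow> \<sigma> \<inter> uminus ` \<sigma> = {0}"

text \<open>
  The empty set is a \<open>face_of\<close> every convex set, but it is not a face of a cone in the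
  sense of toric geometry; hence the side condition \<open>\<tau> \<noteq> {}\<close> below.
\<close>

definition fan :: "(real ^ 'n) set set \<Rightarrow> bool" where
  "fan \<Sigma> \<longleftrightarrow>
     finite \<Sigma> \<and>
     (\<forall>\<sigma>\<in>\<Sigma>. rational_polyhedral_cone \<sigma> \<and> strongly_convex \<sigma>) \<and>
     (\<forall>\<sigma>\<in>\<Sigma>. \<forall>\<tau>. \<tau> face_of \<sigma> \<and> \<tau> \<noteq> {} \<longrightarrow> \<tau> \<in> \<Sigma>) \<and>
     (\<forall>\<sigma>\<in>\<Sigma>. \<forall>\<tau>\<in>\<Sigma>. (\<sigma> \<inter> \<tau>) face_of \<sigma> \<and> (\<sigma> \<inter> \<tau>) face_of \<tau>)"

definition complete_fan :: "(real ^ 'n) set set \<Rightarrow> bool" where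
  "complete_fan \<Sigma> \<longleftrightarrow> fan \<Sigma> \<and> \<Union> \<Sigma> = UNIV"

definition simplicial_cone :: "(real ^ 'n) set \<Rightarrow> bool" where
  "simplicial_cone \<sigma> \<longleftrightarrow> (\<exists>A. independent A \<and> \<sigma> = convex_cone hull A)"

definition simplicial_fan :: "(real ^ 'n) set set \<Rightarrow> bool" where
  "simplicial_fan \<Sigma> \<longleftrightarrow> fan \<Sigma> \<and> (\<forall>\<sigma>\<in>\<Sigma>. simplicial_cone \<sigma>)"

definition fan_rays :: "(real ^ 'n) set set \<Rightarrow> (real ^ 'n) set set" where
  "fan_rays \<Sigma> = {\<rho> \<in> \<Sigma>. dim \<rho> = 1}"

definition primitive :: "int ^ 'n \<Rightarrow> bool" where
  "primitive u \<longleftrightarrow> Gcd (range (\<lambda>j. u $ j)) = 1"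

text \<open>
  The rays are indexed by the finite type \<open>'r\<close>; the \<open>i\<close>-th row of
  \<open>\<phi> :: int ^ 'n ^ 'r\<close> is the primitive generator of the \<open>i\<close>-th ray.
\<close>

definition ray :: "int ^ 'n ^ 'r \<Rightarrow> 'r \<Rightarrow> (real ^ 'n) set" where
  "ray \<phi> i = convex_cone hull {real_vec (\<phi> $ i)}"

definition primitive_ray_generators :: "(real ^ 'n) set set \<Rightarrow> int ^ 'n ^ 'r \<Rightarrow> bool" where
  "primitive_ray_generators \<Sigma> \<phi> \<longleftrightarrow>
     (\<forall>i. primitive (\<phi> $ i)) \<and> bij_betw (ray \<phi>) UNIV (fan_rays \<Sigma>)"


section \<open>The class group sequence and lattices\<close>

text \<open>Exactness of \<open>0 \<rightarrow> \<int>\<^sup>n \<rightarrow> \<int>\<^sup>r \<rightarrow> \<int>\<^sup>d \<rightarrow> 0\<close>.\<close>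

definition short_exact :: "int ^ 'n ^ 'r \<Rightarrow> int ^ 'r ^ 'd \<Rightarrow> bool" where
  "short_exact \<phi> \<beta> \<longleftrightarrow>
     inj ((*v) \<phi>) \<and> range ((*v) \<phi>) = {m. \<beta> *v m = 0} \<and> surj ((*v) \<beta>)"

definition L_beta :: "int ^ 'r ^ 'd \<Rightarrow> (int ^ 'r) set" where
  "L_beta \<beta> = {m. \<beta> *v m = 0}"

definition sublattice :: "(int ^ 'r) set \<Rightarrow> bool" where
  "sublattice L \<longleftrightarrow> 0 \<in> L \<and> (\<forall>x\<in>L. \<forall>y\<in>L. x - y \<in> L)"


section \<open>The Cox ring\<close>

text \<open>
  A polynomial maps exponent vectors in \<open>\<nat>\<^sup>r\<close> to coefficients; multiplication on
  \<open>\<Rightarrow>\<^sub>0\<close> is convolution.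
\<close>

type_synonym ('r, 'f) cox_ring = "('r \<Rightarrow>\<^sub>0 nat) \<Rightarrow>\<^sub>0 'f"

definition var :: "'r \<Rightarrow> ('r, 'f::comm_ring_1) cox_ring" where
  "var i = Poly_Mapping.single (Poly_Mapping.single i 1) 1"

definition ideal_gen :: "'a::comm_ring_1 set \<Rightarrow> 'a set" where
  "ideal_gen = Modules.module.span (*)"

lemma module_times: "Modules.module ((*) :: 'a::comm_ring_1 \<Rightarrow> 'a \<Rightarrow> 'a)"
  by unfold_locales (auto simp: algebra_simps)

lemma ideal_gen_explicit:
  "ideal_gen A = {(\<Sum>a\<in>T. c a * a) | T c. finite T \<and> T \<subseteq> A}"
  unfolding ideal_gen_def by (rule Modules.module.span_explicit[OF module_times])

definition monomial_degree :: "int ^ 'r ^ 'd \<Rightarrow> ('r::finite \<Rightarrow>\<^sub>0 nat) \<Rightarrow> int ^ 'd" where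
  "monomial_degree \<beta> a = (\<Sum>j\<in>UNIV. int (Poly_Mapping.lookup a j) *s column j \<beta>)"

definition homogeneous :: "int ^ 'r ^ 'd \<Rightarrow> ('r::finite, 'f::zero) cox_ring \<Rightarrow> bool" where
  "homogeneous \<beta> F \<longleftrightarrow> (\<exists>\<alpha>. \<forall>a \<in> Poly_Mapping.keys F. monomial_degree \<beta> a = \<alpha>)"

text \<open>\<open>pos_monom m\<close> is \<open>x\<close> to the power \<open>m\<^sup>+\<close>; note that \<open>nat\<close> truncates negative integers to 0.\<close>

definition pos_monom :: "int ^ 'r \<Rightarrow> ('r::finite, 'f::comm_ring_1) cox_ring" where
  "pos_monom m = (\<Prod>j\<in>UNIV. var j ^ nat (m $ j))"

definition neg_monom :: "int ^ 'r \<Rightarrow> ('r::finite, 'f::comm_ring_1) cox_ring" where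
  "neg_monom m = (\<Prod>j\<in>UNIV. var j ^ nat (- (m $ j)))"

definition lattice_ideal :: "(int ^ 'r) set \<Rightarrow> ('r::finite, 'f::comm_ring_1) cox_ring set" where
  "lattice_ideal L = ideal_gen ((\<lambda>m. pos_monom m - neg_monom m) ` L)"

definition irrelevant_ideal ::
    "(real ^ 'n) set set \<Rightarrow> int ^ 'n ^ 'r \<Rightarrow> ('r::finite, 'f::comm_ring_1) cox_ring set" where
  "irrelevant_ideal \<Sigma> \<phi> =
     ideal_gen ((\<lambda>\<sigma>. \<Prod>i\<in>{i. \<not> ray \<phi> i \<subseteq> \<sigma>}. var i) ` \<Sigma>)"


section \<open>Points of the toric variety\<close>

definition field_embedding :: "('f::field \<Rightarrow> 'k::field) \<Rightarrow> bool" where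
  "field_embedding \<iota> \<longleftrightarrow>
     \<iota> 1 = 1 \<and> (\<forall>x y. \<iota> (x + y) = \<iota> x + \<iota> y) \<and> (\<forall>x y. \<iota> (x * y) = \<iota> x * \<iota> y)"

text \<open>
  All coordinates live in the algebraic closure of \<open>'k\<close>; \<open>\<iota>\<close> is the inclusion of
  the coefficient field into \<open>'k\<close>.
\<close>

definition eval_at ::
    "('f::field \<Rightarrow> 'k::field) \<Rightarrow> 'k alg_closure ^ 'r \<Rightarrow> ('r::finite, 'f) cox_ring \<Rightarrow> 'k alg_closure" where
  "eval_at \<iota> P F =
     (\<Sum>a\<in>Poly_Mapping.keys F. to_ac (\<iota> (Poly_Mapping.lookup F a)) *
        (\<Prod>j\<in>UNIV. (P $ j) ^ Poly_Mapping.lookup a j))"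

definition affine_zero_set ::
    "('f::field \<Rightarrow> 'k::field) \<Rightarrow> ('r::finite, 'f) cox_ring set \<Rightarrow> ('k alg_closure ^ 'r) set" where
  "affine_zero_set \<iota> J = {P. \<forall>F\<in>J. eval_at \<iota> P F = 0}"

definition rational_points :: "('k::field alg_closure ^ 'r) set" where
  "rational_points = {P. \<forall>j. P $ j \<in> range to_ac}"

definition group_G :: "int ^ 'r ^ 'd \<Rightarrow> ('k::field alg_closure ^ 'r) set" where
  "group_G \<beta> = {P. (\<forall>j. P $ j \<noteq> 0) \<and> (\<forall>m\<in>L_beta \<beta>. (\<Prod>j\<in>UNIV. (P $ j) powi (m $ j)) = 1)}"

definition G_orbit ::
    "int ^ 'r ^ 'd \<Rightarrow> 'k::field alg_closure ^ 'r \<Rightarrow> ('k alg_closure ^ 'r) set" where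
  "G_orbit \<beta> P = (\<lambda>g. \<chi> j. g $ j * P $ j) ` group_G \<beta>"

text \<open>
  \<open>X(K)\<close>: the \<open>G\<close>-orbits, taken over the algebraic closure, of the
  \<open>K\<close>-points outside \<open>V(B)\<close>.
\<close>

definition toric_points ::
    "('f::field \<Rightarrow> 'k::field) \<Rightarrow> (real ^ 'n) set set \<Rightarrow> int ^ 'n ^ 'r \<Rightarrow> int ^ 'r ^ 'd \<Rightarrow>
     ('k alg_closure ^ 'r) set set" where
  "toric_points \<iota> \<Sigma> \<phi> \<beta> =
     G_orbit \<beta> ` (rational_points -
       affine_zero_set \<iota> (irrelevant_ideal \<Sigma> \<phi> :: ('r::finite, 'f) cox_ring set))"

text \<open>
  Elements of \<open>G\<close> scale the value of a homogeneous polynomial by a nonzero factor, so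
  for homogeneous \<open>F\<close> vanishing at one representative of an orbit is the same as
  vanishing at all of them.
\<close>

definition vanishes_at ::
    "('f::field \<Rightarrow> 'k::field) \<Rightarrow> ('r::finite, 'f) cox_ring \<Rightarrow> ('k alg_closure ^ 'r) set \<Rightarrow> bool" where
  "vanishes_at \<iota> F p \<longleftrightarrow> (\<forall>P\<in>p. eval_at \<iota> P F = 0)"

definition toric_zero_set ::
    "('f::field \<Rightarrow> 'k::field) \<Rightarrow> (real ^ 'n) set set \<Rightarrow> int ^ 'n ^ 'r \<Rightarrow> int ^ 'r ^ 'd \<Rightarrow>
     ('r::finite, 'f) cox_ring set \<Rightarrow> ('k alg_closure ^ 'r) set set" where
  "toric_zero_set \<iota> \<Sigma> \<phi> \<beta> J =
     {p \<in> toric_points \<iota> \<Sigma> \<phi> \<beta>. \<forall>F\<in>J. homogeneous \<beta> F \<longrightarrow> vanishes_at \<iota> F p}"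

definition vanishing_ideal ::
    "('f::field \<Rightarrow> 'k::field) \<Rightarrow> int ^ 'r ^ 'd \<Rightarrow> ('k alg_closure ^ 'r) set set \<Rightarrow>
     ('r::finite, 'f) cox_ring set" where
  "vanishing_ideal \<iota> \<beta> Y = ideal_gen {F. homogeneous \<beta> F \<and> (\<forall>p\<in>Y. vanishes_at \<iota> F p)}"

end

theory Submission
  imports Defs
begin

text \<open>
  Put \<open>N = q - 1\<close>.  Binomial generators of \<open>I\<^sub>L\<close> are homogeneous because \<open>L \<subseteq> L\<^sub>\<beta>\<close>, and they
  vanish on \<open>V(I\<^sub>L)\<close> by definition, so only \<open>I(V(I\<^sub>L)) \<subseteq> I\<^sub>L\<close> needs an argument.  For this
  inclusion finitely many points suffice, and they are defined over the coefficient field: the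
  points of \<open>H = {P \<in> (\<bbbF>\<^sub>q\<^sup>*)\<^sup>r. P\<^sup>m = 1 for all m \<in> L}\<close>.  Their orbits lie in \<open>V(I\<^sub>L)\<close>
  whatever \<open>\<bbbK>\<close> is, since all coordinates are nonzero and the elements of \<open>G\<close> do not change
  \<open>P\<^sup>m\<close> for \<open>m \<in> L \<subseteq> L\<^sub>\<beta>\<close> (lemma \<open>torus_orbit_in_toric_zero_set\<close>).

  Let \<open>F = \<Sum> c\<^sub>a x\<^sup>a\<close> be homogeneous and zero on \<open>H\<close>.  The function
  \<open>E(P) = \<Sum>\<^sub>s P\<^sup>s\<close>, with \<open>s\<close> running over \<open>L\<close> modulo \<open>N\<close>, is zero at the points of
  \<open>(\<bbbF>\<^sub>q\<^sup>*)\<^sup>r\<close> outside \<open>H\<close>, as a sum of a nontrivial character of a group.  Hence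
  \<open>F(P) E(P) P\<^sup>-\<^sup>b\<close> is zero on the whole of \<open>(\<bbbF>\<^sub>q\<^sup>*)\<^sup>r\<close>.  Summing it over this torus isolates
  the exponents \<open>a + s - b\<close> in \<open>N \<int>\<^sup>r\<close> and shows that the sum of those \<open>c\<^sub>a\<close> with
  \<open>a \<equiv> b\<close> modulo \<open>L + N \<int>\<^sup>r\<close> is zero (lemma \<open>lattice_class_coeff_sum_eq_0\<close>).  This replaces
  the duality between sublattices and subgroups of the torus.

  The exponents of \<open>F\<close> differ by elements of \<open>L\<^sub>\<beta>\<close>, and
  \<open>L\<^sub>\<beta> \<inter> (L + N \<int>\<^sup>r) = L + N L\<^sub>\<beta> = L\<close>: the first equality holds because \<open>L\<^sub>\<beta>\<close> is the
  kernel of a map into a torsion-free group, the second by the assumption \<open>N L\<^sub>\<beta> \<subseteq> L\<close> (lemma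
  \<open>saturated_sublattice\<close>).  So already the sums of the \<open>c\<^sub>a\<close> over the classes modulo \<open>L\<close> are
  zero, and \<open>F\<close> is a combination of differences \<open>x\<^sup>a - x\<^sup>b\<close> with \<open>a - b \<in> L\<close>, each of which
  is a monomial times a generator of \<open>I\<^sub>L\<close> (lemma \<open>in_lattice_ideal_if_class_sums_eq_0\<close>).
\<close>

unbundle no fps_syntax

section \<open>Laurent monomials on the torus\<close>

definition torus :: "('a::zero ^ 'r) set" where
  "torus = {P. \<forall>j. P $ j \<noteq> 0}"

definition laurent :: "'a::field ^ 'r \<Rightarrow> int ^ 'r \<Rightarrow> 'a" where
  "laurent P m = (\<Prod>j\<in>UNIV. P $ j powi (m $ j))"

lemma laurent_nonzero: "P \<in> torus \<Longrightarrow> laurent P m \<noteq> 0"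
  by (simp add: laurent_def torus_def)

lemma laurent_add: "P \<in> torus \<Longrightarrow> laurent P (m + m') = laurent P m * laurent P m'"
  by (simp add: laurent_def torus_def power_int_add prod.distrib)

lemma laurent_diff: "P \<in> torus \<Longrightarrow> laurent P (m - m') = laurent P m / laurent P m'"
  by (simp add: laurent_def torus_def power_int_diff prod_dividef)

lemma laurent_mult_point:
  "laurent (\<chi> j. P $ j * Q $ j) m = laurent P m * laurent Q m"
  by (simp add: laurent_def power_int_mult_distrib prod.distrib)

text \<open>
  Choosing the representative of a class modulo \<open>N \<int>\<^sup>r\<close> in the box \<open>[0, N)\<^sup>r\<close> makes the image of
  a lattice in \<open>(\<int>/N)\<^sup>r\<close> a finite set of integer vectors, over which character sums can be taken.
\<close>

definition reduce :: "int \<Rightarrow> int ^ 'r \<Rightarrow> int ^ 'r" where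
  "reduce N x = (\<chi> j. x $ j mod N)"

lemma reduce_eq_iff: "reduce N x = reduce N y \<longleftrightarrow> (\<forall>j. N dvd (x - y) $ j)"
  by (simp add: reduce_def vec_eq_iff mod_eq_dvd_iff)

lemma reduce_reduce_add [simp]: "reduce N (reduce N x + y) = reduce N (x + y)"
  by (simp add: reduce_def vec_eq_iff mod_add_left_eq)

lemma reduce_0 [simp]: "reduce N 0 = 0"
  by (simp add: reduce_def vec_eq_iff)

lemma finite_range_reduce:
  assumes "N > 0"
  shows "finite (range (reduce N :: int ^ 'r \<Rightarrow> _))"
proof -
  have "range (reduce N :: int ^ 'r \<Rightarrow> _) \<subseteq> vec_lambda ` (UNIV \<rightarrow>\<^sub>E {0..<N})"
  proof safe
    fix x :: "int ^ 'r"
    show "reduce N x \<in> vec_lambda ` (UNIV \<rightarrow>\<^sub>E {0..<N})"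
      using assms by (intro image_eqI[where x = "\<lambda>j. x $ j mod N"]) (auto simp: reduce_def)
  qed
  then show ?thesis
    by (rule finite_subset) (intro finite_imageI finite_PiE, auto)
qed

section \<open>Character sums over the torus of a finite field\<close>

lemma card_field_gt_1: "CARD('f::{field,finite}) > 1"
proof -
  have "card {0, 1 :: 'f} \<le> CARD('f)"
    by (rule card_mono) auto
  then show ?thesis by simp
qed

lemma unit_power_card_minus_1:
  fixes u :: "'f::{field,finite}"
  assumes "u \<noteq> 0"
  shows "u powi (int CARD('f) - 1) = 1"
proof -
  have "(\<Prod>y\<in>UNIV - {0::'f}. y) = (\<Prod>y\<in>UNIV - {0}. u * y)"
    using assms
    by (intro prod.reindex_bij_witness[where j = "\<lambda>y. y / u" and i = "\<lambda>y. u * y"]) auto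
  also have "\<dots> = u ^ (CARD('f) - 1) * (\<Prod>y\<in>UNIV - {0}. y)"
    by (simp add: prod.distrib card_Diff_subset)
  finally have "u ^ (CARD('f) - 1) = 1"
    by simp
  moreover have "int CARD('f) - 1 = int (CARD('f) - 1)"
    using card_field_gt_1[where 'f = 'f] by (simp add: of_nat_diff)
  ultimately show ?thesis
    by (simp only: power_int_of_nat)
qed

lemma unit_powi_dvd:
  fixes u :: "'f::{field,finite}"
  assumes "u \<noteq> 0" "(int CARD('f) - 1) dvd e"
  shows "u powi e = 1"
  using assms by (elim dvdE) (simp add: power_int_mult unit_power_card_minus_1)

lemma of_nat_card_field: "of_nat CARD('f) = (0 :: 'f::{field,finite})"
proof -
  have "(\<Sum>x\<in>(UNIV::'f set). x) = (\<Sum>x\<in>UNIV. x + 1)"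
    by (rule sum.reindex_bij_witness[where j = "\<lambda>x. x - 1" and i = "\<lambda>x. x + 1"]) auto
  then show ?thesis
    by (simp add: sum.distrib)
qed

text \<open>
  If \<open>u\<^sup>e = 1\<close> held for all units \<open>u\<close>, then \<open>u\<^sup>k = 1\<close> for the remainder \<open>k > 0\<close> of \<open>e\<close> modulo
  \<open>q - 1\<close>, and \<open>x\<^sup>k - 1\<close> would have \<open>q - 1 > k\<close> roots.  This root count takes the place of a generator of the
  unit group.
\<close>

lemma ex_unit_powi_neq_1:
  fixes e :: int
  assumes "\<not> (int CARD('f) - 1) dvd e"
  shows "\<exists>u::'f::{field,finite}. u \<noteq> 0 \<and> u powi e \<noteq> 1"
proof (rule ccontr)
  assume contra: "\<not> ?thesis"
  define N where "N = int CARD('f) - 1"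
  define k where "k = nat (e mod N)"
  have N: "N > 0"
    using card_field_gt_1[where 'f = 'f] by (simp add: N_def)
  have k: "int k = e mod N" "k > 0" "int k < N"
    using assms pos_mod_sign[OF N, of e] pos_mod_bound[OF N, of e]
    unfolding k_def dvd_eq_mod_eq_0 N_def[symmetric] by linarith+
  define p :: "'f poly" where "p = Polynomial.monom 1 k - 1"
  have coeff_k: "poly.coeff p k = 1"
    using k(2) by (simp add: p_def)
  then have "p \<noteq> 0" by auto
  have "Polynomial.degree p \<le> k"
    unfolding p_def by (intro degree_diff_le) (auto simp: degree_monom_le)
  have "poly p u = 0" if "u \<noteq> 0" for u
  proof -
    have "u powi e = u powi (N * (e div N) + int k)"
      by (simp add: k)
    also have "\<dots> = u ^ k"
      using that by (simp add: power_int_add unit_powi_dvd N_def)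
    finally show ?thesis
      using contra that by (auto simp: p_def poly_monom)
  qed
  then have "card (UNIV - {0::'f}) \<le> card {u. poly p u = 0}"
    by (intro card_mono) auto
  also have "\<dots> \<le> k"
    using card_poly_roots_bound[OF \<open>p \<noteq> 0\<close>] \<open>Polynomial.degree p \<le> k\<close> by simp
  finally have "CARD('f) - 1 \<le> k"
    by (simp add: card_Diff_subset)
  with k(3) show False
    by (simp add: N_def)
qed

text \<open>
  For a trivial character the sum counts the units, and \<open>q - 1 = - 1\<close> in the field.  For a
  nontrivial one, translation by a unit \<open>w\<close> with \<open>w\<^sup>e \<noteq> 1\<close> multiplies the sum by \<open>w\<^sup>e\<close>.
\<close>

lemma sum_units_powi:
  "(\<Sum>u\<in>UNIV - {0::'f::{field,finite}}. u powi e) = (if (int CARD('f) - 1) dvd e then - 1 else 0)"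
proof (cases "(int CARD('f) - 1) dvd e")
  case True
  have "(\<Sum>u\<in>UNIV - {0::'f}. u powi e) = (\<Sum>u\<in>UNIV - {0::'f}. 1)"
    using True by (intro sum.cong) (auto simp: unit_powi_dvd)
  also have "\<dots> = - 1"
    using card_field_gt_1[where 'f = 'f]
    by (simp add: card_Diff_subset of_nat_diff of_nat_card_field)
  finally show ?thesis
    using True by simp
next
  case False
  then obtain w :: 'f where w: "w \<noteq> 0" "w powi e \<noteq> 1"
    using ex_unit_powi_neq_1 by blast
  have "(\<Sum>u\<in>UNIV - {0::'f}. u powi e) = (\<Sum>u\<in>UNIV - {0::'f}. (w * u) powi e)"
    using w by (intro sum.reindex_bij_witness[where j = "\<lambda>u. u / w" and i = "\<lambda>u. w * u"]) auto
  also have "\<dots> = w powi e * (\<Sum>u\<in>UNIV - {0::'f}. u powi e)"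
    by (simp add: power_int_mult_distrib sum_distrib_left)
  finally show ?thesis
    using False w by simp
qed

text \<open>
  Orthogonality on the torus: the sum factors into one sum over the units per coordinate.  What
  matters later is that the value in the trivial case is invertible in the field.
\<close>

lemma sum_torus_laurent:
  fixes m :: "int ^ 'r"
  shows "(\<Sum>P\<in>torus. laurent (P :: 'f::{field,finite} ^ 'r) m) =
    (if reduce (int CARD('f) - 1) m = 0 then (- 1) ^ CARD('r) else 0)"
proof -
  have "(\<Sum>P\<in>torus. laurent (P :: 'f ^ 'r) m) =
      (\<Sum>g\<in>UNIV \<rightarrow>\<^sub>E UNIV - {0}. \<Prod>j\<in>UNIV. g j powi (m $ j))"
    by (rule sum.reindex_bij_witness[where i = vec_lambda and j = vec_nth])
      (auto simp: torus_def laurent_def vec_nth_inverse PiE_def Pi_def extensional_def)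
  also have "\<dots> = (\<Prod>j\<in>UNIV. \<Sum>u\<in>UNIV - {0::'f}. u powi (m $ j))"
    by (rule prod_sum_PiE[symmetric]) auto
  also have "\<dots> = (if \<forall>j. (int CARD('f) - 1) dvd m $ j then (- 1) ^ CARD('r) else 0)"
    by (auto simp: sum_units_powi)
  also have "(\<forall>j. (int CARD('f) - 1) dvd m $ j) \<longleftrightarrow> reduce (int CARD('f) - 1) m = 0"
    by (simp add: reduce_def vec_eq_iff dvd_eq_mod_eq_0)
  finally show ?thesis .
qed

lemma laurent_reduce:
  fixes P :: "'f::{field,finite} ^ 'r"
  assumes "P \<in> torus"
  shows "laurent P (reduce (int CARD('f) - 1) m) = laurent P m"
proof -
  let ?N = "int CARD('f) - 1"
  have "laurent P (m - reduce ?N m) = 1"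
    using assms unfolding laurent_def
    by (intro prod.neutral) (auto simp: torus_def reduce_def intro!: unit_powi_dvd dvd_minus_mod)
  then show ?thesis
    using assms laurent_nonzero[OF assms] by (simp add: laurent_diff)
qed

section \<open>Lattices of characters\<close>

lemma sublattice_uminus:
  assumes "sublattice L" "x \<in> L"
  shows "- x \<in> L"
proof -
  have "0 - x \<in> L"
    using assms unfolding sublattice_def by blast
  then show ?thesis by simp
qed

lemma sublattice_add:
  assumes "sublattice L" "x \<in> L" "y \<in> L"
  shows "x + y \<in> L"
proof -
  have "x - (- y) \<in> L"
    using assms sublattice_uminus unfolding sublattice_def by blast
  then show ?thesis by simp
qed

text \<open>
  Since \<open>s \<mapsto> P\<^sup>s\<close> is a character of \<open>L\<close> modulo \<open>q - 1\<close>, translation by an \<open>m\<^sub>0\<close> on which it is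
  not 1 permutes the terms of the sum and multiplies it by a factor other than 1.
\<close>

lemma sum_lattice_laurent_eq_0:
  fixes P :: "'f::{field,finite} ^ 'r"
  assumes P: "P \<in> torus" and L: "sublattice L" and m0: "m0 \<in> L" "laurent P m0 \<noteq> 1"
  shows "(\<Sum>s\<in>reduce (int CARD('f) - 1) ` L. laurent P s) = 0"
proof -
  let ?N = "int CARD('f) - 1"
  let ?E = "\<Sum>s\<in>reduce ?N ` L. laurent P s"
  have "?E = (\<Sum>s\<in>reduce ?N ` L. laurent P (reduce ?N (s + m0)))"
  proof (rule sum.reindex_bij_witness[where j = "\<lambda>s. reduce ?N (s - m0)" and
        i = "\<lambda>s. reduce ?N (s + m0)"])
    fix s assume "s \<in> reduce ?N ` L"
    then obtain m where m: "m \<in> L" "s = reduce ?N m" by blast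
    have minus: "reduce ?N (reduce ?N m - m0) = reduce ?N (m - m0)"
      using reduce_reduce_add[of ?N m "- m0"] by simp
    have "m - m0 \<in> L" "m + m0 \<in> L"
      using L m m0 sublattice_add by (auto simp: sublattice_def)
    then show "reduce ?N (s - m0) \<in> reduce ?N ` L" "reduce ?N (s + m0) \<in> reduce ?N ` L"
      using m minus by auto
    show "reduce ?N (reduce ?N (s - m0) + m0) = s"
      using m minus by simp
    show "reduce ?N (reduce ?N (s + m0) - m0) = s"
      using m reduce_reduce_add[of ?N "m + m0" "- m0"] by simp
    show "laurent P (reduce ?N (reduce ?N (s - m0) + m0)) = laurent P s"
      using m minus by simp
  qed
  also have "\<dots> = laurent P m0 * ?E"
    using P by (simp add: laurent_reduce laurent_add sum_distrib_left mult.commute)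
  finally show ?thesis
    using m0 by simp
qed

text \<open>
  If \<open>\<Sum> c\<^sub>a P\<^bsup>v(a)\<^esup>\<close> vanishes where all \<open>P\<^sup>m\<close> with \<open>m \<in> L\<close> are 1, its product with \<open>\<Sum>\<^sub>s P\<^sup>s\<close>, for \<open>s\<close> in
  \<open>L\<close> modulo \<open>q - 1\<close>, vanishes at every point of the torus.  By orthogonality, summing that
  product times \<open>P\<^sup>-\<^sup>b\<close> over the torus keeps, for each \<open>a\<close>, at most one \<open>s\<close>, namely the class of
  \<open>b - v(a)\<close>.
\<close>

lemma lattice_class_coeff_sum_eq_0:
  fixes c :: "'i \<Rightarrow> 'f::{field,finite}" and v :: "'i \<Rightarrow> int ^ 'r" and b :: "int ^ 'r"
  assumes A: "finite A" and L: "sublattice L"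
    and vanish: "\<And>P. P \<in> torus \<Longrightarrow> (\<And>m. m \<in> L \<Longrightarrow> laurent P m = 1) \<Longrightarrow>
      (\<Sum>a\<in>A. c a * laurent P (v a)) = 0"
  shows "(\<Sum>a | a \<in> A \<and> reduce (int CARD('f) - 1) (b - v a) \<in> reduce (int CARD('f) - 1) ` L. c a) = 0"
proof -
  let ?N = "int CARD('f) - 1"
  let ?S = "reduce ?N ` L"
  have finS: "finite ?S"
    using finite_range_reduce[of ?N] card_field_gt_1[where 'f = 'f]
    by (auto intro: finite_subset[of _ "range (reduce ?N)"])
  have shift: "reduce ?N (v a + s - b) = 0 \<longleftrightarrow> s = reduce ?N (b - v a)" if "s \<in> ?S" for a s
  proof -
    have s: "s = reduce ?N s"
      using that by (auto simp: reduce_def vec_eq_iff)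
    have "reduce ?N (v a + s - b) = reduce ?N 0 \<longleftrightarrow> reduce ?N s = reduce ?N (b - v a)"
      unfolding reduce_eq_iff by (simp add: algebra_simps)
    then show ?thesis
      using s by (metis reduce_0)
  qed
  have "0 = (\<Sum>P\<in>torus. (\<Sum>a\<in>A. c a * laurent P (v a)) * (\<Sum>s\<in>?S. laurent P s) * laurent P (- b))"
  proof (rule sum.neutral[symmetric], intro ballI)
    fix P :: "'f ^ 'r" assume P: "P \<in> torus"
    show "(\<Sum>a\<in>A. c a * laurent P (v a)) * (\<Sum>s\<in>?S. laurent P s) * laurent P (- b) = 0"
    proof (cases "\<forall>m\<in>L. laurent P m = 1")
      case True
      then show ?thesis using vanish[OF P] by simp
    next
      case False
      then show ?thesis using sum_lattice_laurent_eq_0[OF P L] by auto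
    qed
  qed
  also have "\<dots> = (\<Sum>P\<in>torus. \<Sum>a\<in>A. \<Sum>s\<in>?S. c a * laurent P (v a + s - b))"
  proof (rule sum.cong[OF refl])
    fix P :: "'f ^ 'r" assume P: "P \<in> torus"
    have "laurent P (v a + s - b) = laurent P (v a) * laurent P s * laurent P (- b)" for a s
      using laurent_add[OF P, of "v a + s" "- b"] laurent_add[OF P, of "v a" s] by simp
    then have "(\<Sum>a\<in>A. \<Sum>s\<in>?S. c a * laurent P (v a + s - b)) =
        (\<Sum>a\<in>A. \<Sum>s\<in>?S. c a * laurent P (v a) * laurent P s) * laurent P (- b)"
      by (simp add: sum_distrib_right mult.assoc)
    then show "(\<Sum>a\<in>A. c a * laurent P (v a)) * (\<Sum>s\<in>?S. laurent P s) * laurent P (- b) =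
        (\<Sum>a\<in>A. \<Sum>s\<in>?S. c a * laurent P (v a + s - b))"
      by (simp only: sum_product)
  qed
  also have "\<dots> = (\<Sum>a\<in>A. \<Sum>P\<in>torus. \<Sum>s\<in>?S. c a * laurent P (v a + s - b))"
    by (rule sum.swap)
  also have "\<dots> = (\<Sum>a\<in>A. \<Sum>s\<in>?S. \<Sum>P\<in>(torus :: ('f ^ 'r) set). c a * laurent P (v a + s - b))"
    by (intro sum.cong[OF refl] sum.swap)
  also have "\<dots> = (\<Sum>a\<in>A. \<Sum>s\<in>?S. if s = reduce ?N (b - v a) then c a * (- 1) ^ CARD('r) else 0)"
    by (intro sum.cong[OF refl]) (auto simp: sum_torus_laurent shift simp flip: sum_distrib_left)
  also have "\<dots> = (\<Sum>a\<in>A. if reduce ?N (b - v a) \<in> ?S then c a * (- 1) ^ CARD('r) else 0)"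
    using finS by (simp add: sum.delta)
  also have "\<dots> = (- 1) ^ CARD('r) * (\<Sum>a | a \<in> A \<and> reduce ?N (b - v a) \<in> ?S. c a)"
    using A by (auto simp: sum.inter_filter sum_distrib_left intro!: sum.cong)
  finally show ?thesis by simp
qed

section \<open>Ideals generated by a set\<close>

lemmas ideal_gen_base = Modules.module.span_base[OF module_times, folded ideal_gen_def]
  and ideal_gen_scale = Modules.module.span_scale[OF module_times, folded ideal_gen_def]
  and ideal_gen_sum = Modules.module.span_sum[OF module_times, folded ideal_gen_def]

lemma ideal_gen_subset:
  assumes "A \<subseteq> ideal_gen B"
  shows "ideal_gen A \<subseteq> ideal_gen B"
  using assms unfolding ideal_gen_def
  by (intro Modules.module.span_minimal[OF module_times]
      Modules.module.subspace_span[OF module_times])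

section \<open>Monomials and exponent vectors\<close>

definition exponent :: "('r::finite \<Rightarrow>\<^sub>0 nat) \<Rightarrow> int ^ 'r" where
  "exponent a = (\<chi> j. int (Poly_Mapping.lookup a j))"

abbreviation monomial :: "('r \<Rightarrow>\<^sub>0 nat) \<Rightarrow> ('r, 'f::comm_ring_1) cox_ring" where
  "monomial a \<equiv> Poly_Mapping.single a 1"

definition pos_exponent :: "int ^ 'r \<Rightarrow> ('r::finite \<Rightarrow>\<^sub>0 nat)" where
  "pos_exponent m = (\<Sum>j\<in>UNIV. Poly_Mapping.single j (nat (m $ j)))"

lemma lookup_pos_exponent [simp]: "Poly_Mapping.lookup (pos_exponent m) j = nat (m $ j)"
  by (simp add: pos_exponent_def lookup_sum lookup_single when_def)

lemma var_power: "var i ^ k = monomial (Poly_Mapping.single i k)"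
  by (induction k) (simp_all add: var_def mult_single single_add[symmetric])

lemma prod_monomial: "(\<Prod>j\<in>J. monomial (f j)) = monomial (\<Sum>j\<in>J. f j)"
  by (induction J rule: infinite_finite_induct) (simp_all add: mult_single)

lemma pos_monom_eq: "pos_monom m = monomial (pos_exponent m)"
  by (simp add: pos_monom_def var_power prod_monomial pos_exponent_def)

lemma neg_monom_eq: "neg_monom m = monomial (pos_exponent (- m))"
  by (simp add: neg_monom_def var_power prod_monomial pos_exponent_def)

lemma exponent_pos_diff: "exponent (pos_exponent m) - exponent (pos_exponent (- m)) = m"
  by (auto simp: exponent_def vec_eq_iff)

lemma cox_ring_expand:
  fixes F :: "('r, 'f::comm_ring_1) cox_ring"
  assumes "finite A" "Poly_Mapping.keys F \<subseteq> A"
  shows "F = (\<Sum>a\<in>A. Poly_Mapping.single a (Poly_Mapping.lookup F a))"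
  using assms by (intro poly_mapping_eqI)
    (auto simp: lookup_sum lookup_single when_def in_keys_iff)

text \<open>
  With \<open>m = a - b\<close>, both exponents arise from \<open>m\<^sup>+\<close> and \<open>m\<^sup>-\<close> by adding their common part
  \<open>min a b = a - m\<^sup>+\<close>.
\<close>

lemma monomial_diff_in_lattice_ideal:
  assumes "exponent a - exponent b \<in> L"
  shows "(monomial a - monomial b :: ('r::finite, 'f::comm_ring_1) cox_ring) \<in> lattice_ideal L"
proof -
  define m where "m = exponent a - exponent b"
  define c where "c = a - pos_exponent m"
  have "a = c + pos_exponent m" "b = c + pos_exponent (- m)"
    by (rule poly_mapping_eqI,
        simp add: c_def m_def lookup_add lookup_minus exponent_def)+
  then have "(monomial a - monomial b :: ('r, 'f) cox_ring) = monomial c * (pos_monom m - neg_monom m)"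
    by (simp add: pos_monom_eq neg_monom_eq mult_single right_diff_distrib)
  then show ?thesis
    using assms unfolding lattice_ideal_def m_def[symmetric]
    by (simp add: ideal_gen_scale ideal_gen_base)
qed

text \<open>
  Replacing every monomial of \<open>F\<close> by a chosen representative of its class modulo \<open>L\<close> changes \<open>F\<close>
  by an element of the lattice ideal, and the result has the class sums as coefficients.
\<close>

lemma in_lattice_ideal_if_class_sums_eq_0:
  fixes F :: "('r::finite, 'f::comm_ring_1) cox_ring"
  assumes L: "sublattice L"
    and sums: "\<And>b. (\<Sum>a | a \<in> Poly_Mapping.keys F \<and> exponent a - exponent b \<in> L.
      Poly_Mapping.lookup F a) = 0"
  shows "F \<in> lattice_ideal L"
proof -
  let ?c = "Poly_Mapping.lookup F" and ?K = "Poly_Mapping.keys F"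
  define rep :: "('r \<Rightarrow>\<^sub>0 nat) \<Rightarrow> ('r \<Rightarrow>\<^sub>0 nat)"
    where "rep a = (SOME b. exponent a - exponent b \<in> L)" for a
  have rep: "exponent a - exponent (rep a) \<in> L" for a
    unfolding rep_def
    by (rule someI[of "\<lambda>b. exponent a - exponent b \<in> L" a]) (use L in \<open>simp add: sublattice_def\<close>)
  have rep_cong: "rep a = rep b" if ab: "exponent a - exponent b \<in> L" for a b
  proof -
    have "exponent a - exponent x \<in> L \<longleftrightarrow> exponent b - exponent x \<in> L" for x
    proof
      assume "exponent b - exponent x \<in> L"
      then have "(exponent a - exponent b) + (exponent b - exponent x) \<in> L"
        using L ab sublattice_add by blast
      then show "exponent a - exponent x \<in> L" by simp
    next
      assume "exponent a - exponent x \<in> L"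
      then have "(exponent a - exponent x) - (exponent a - exponent b) \<in> L"
        using L ab unfolding sublattice_def by blast
      then show "exponent b - exponent x \<in> L" by simp
    qed
    then show ?thesis by (simp add: rep_def)
  qed
  have class_iff: "rep a = rep b \<longleftrightarrow> exponent a - exponent b \<in> L" for a b
  proof
    assume "rep a = rep b"
    then have "(exponent a - exponent (rep a)) - (exponent b - exponent (rep a)) \<in> L"
      using L rep[of a] rep[of b] unfolding sublattice_def by metis
    then show "exponent a - exponent b \<in> L" by simp
  qed (rule rep_cong)
  (* The polynomial obtained by moving all coefficients to the representatives. *)
  have reps: "(\<Sum>a\<in>?K. Poly_Mapping.single (rep a) (?c a)) = 0"
  proof -
    have "(\<Sum>a\<in>?K. Poly_Mapping.single (rep a) (?c a)) =
        (\<Sum>y\<in>rep ` ?K. \<Sum>a | a \<in> ?K \<and> rep a = y. Poly_Mapping.single (rep a) (?c a))"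
      by (rule sum.image_gen) simp
    also have "\<dots> = 0"
    proof (rule sum.neutral, safe)
      fix b assume "b \<in> ?K"
      have single_sum: "(\<Sum>a\<in>T. Poly_Mapping.single (rep b) (?c a)) =
          Poly_Mapping.single (rep b) (\<Sum>a\<in>T. ?c a)" for T
        by (induction T rule: infinite_finite_induct) (simp_all add: single_add)
      have "(\<Sum>a | a \<in> ?K \<and> rep a = rep b. Poly_Mapping.single (rep a) (?c a)) =
          (\<Sum>a | a \<in> ?K \<and> rep a = rep b. Poly_Mapping.single (rep b) (?c a))"
        by (rule sum.cong) auto
      also have "\<dots> = 0"
        using sums[of b] by (simp add: single_sum class_iff)
      finally show "(\<Sum>a | a \<in> ?K \<and> rep a = rep b. Poly_Mapping.single (rep a) (?c a)) = 0" .
    qed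
    finally show ?thesis .
  qed
  have term_eq: "Poly_Mapping.single a (?c a) - Poly_Mapping.single (rep a) (?c a) =
      Poly_Mapping.single 0 (?c a) * (monomial a - monomial (rep a))" for a
    by (simp add: mult_single right_diff_distrib)
  have "F = (\<Sum>a\<in>?K. Poly_Mapping.single a (?c a)) - (\<Sum>a\<in>?K. Poly_Mapping.single (rep a) (?c a))"
    using cox_ring_expand[of ?K F] reps by simp
  also have "\<dots> = (\<Sum>a\<in>?K. Poly_Mapping.single 0 (?c a) * (monomial a - monomial (rep a)))"
    by (simp only: sum_subtractf[symmetric] term_eq)
  also have "\<dots> \<in> lattice_ideal L"
    unfolding lattice_ideal_def
    using monomial_diff_in_lattice_ideal[OF rep]
    by (intro ideal_gen_sum ideal_gen_scale) (simp add: lattice_ideal_def)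
  finally show ?thesis .
qed

section \<open>Degrees\<close>

lemma matrix_vector_mult_scale:
  fixes M :: "int ^ 'r ^ 'd"
  shows "M *v (k *s x) = k *s (M *v x)"
  by (simp add: matrix_vector_mult_def vec_eq_iff sum_distrib_left mult_ac)

lemma matrix_vector_mult_diff:
  fixes M :: "int ^ 'r ^ 'd"
  shows "M *v (x - y) = M *v x - M *v y"
  by (simp add: matrix_vector_mult_def vec_eq_iff sum_subtractf right_diff_distrib)

lemma monomial_degree_eq: "monomial_degree \<beta> a = \<beta> *v exponent a"
  by (simp add: monomial_degree_def exponent_def matrix_vector_mult_def column_def vec_eq_iff
      mult.commute)

lemma monomial_degree_eq_iff:
  "monomial_degree \<beta> a = monomial_degree \<beta> b \<longleftrightarrow> exponent a - exponent b \<in> L_beta \<beta>"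
  by (simp add: monomial_degree_eq L_beta_def matrix_vector_mult_diff)

lemma homogeneous_binomial:
  assumes "m \<in> L_beta \<beta>"
  shows "homogeneous \<beta> (pos_monom m - neg_monom m :: ('r::finite, 'f::comm_ring_1) cox_ring)"
proof -
  have deg: "monomial_degree \<beta> (pos_exponent m) = monomial_degree \<beta> (pos_exponent (- m))"
    using assms by (simp add: monomial_degree_eq_iff exponent_pos_diff)
  have "Poly_Mapping.keys (pos_monom m - neg_monom m :: ('r, 'f) cox_ring)
      \<subseteq> {pos_exponent m, pos_exponent (- m)}"
    by (auto simp: pos_monom_eq neg_monom_eq in_keys_iff lookup_minus lookup_single when_def
        split: if_splits)
  then show ?thesis
    unfolding homogeneous_def using deg
    by (intro exI[of _ "monomial_degree \<beta> (pos_exponent m)"]) auto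
qed

text \<open>
  \<open>L\<^sub>\<beta> \<inter> (L + N \<int>\<^sup>r) \<subseteq> L\<close>: if \<open>x = m + N z\<close>, then \<open>N (\<beta> z) = 0\<close>, so \<open>z \<in> L\<^sub>\<beta>\<close> and
  \<open>N z \<in> L\<close>.
\<close>

lemma saturated_sublattice:
  fixes L :: "(int ^ 'r) set" and \<beta> :: "int ^ 'r ^ 'd"
  assumes N: "N \<noteq> 0" and L: "sublattice L" "L \<subseteq> L_beta \<beta>" "(\<lambda>m. N *s m) ` L_beta \<beta> \<subseteq> L"
    and x: "x \<in> L_beta \<beta>" "reduce N x \<in> reduce N ` L"
  shows "x \<in> L"
proof -
  obtain m where m: "m \<in> L" "reduce N x = reduce N m"
    using x(2) by blast
  define z :: "int ^ 'r" where "z = (\<chi> j. (x - m) $ j div N)"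
  have z: "N *s z = x - m"
    using m(2) unfolding reduce_eq_iff z_def by (simp add: vec_eq_iff)
  have "N *s (\<beta> *v z) = 0"
    using x(1) m(1) L(2)
    by (auto simp: matrix_vector_mult_scale[symmetric] z matrix_vector_mult_diff L_beta_def)
  then have "z \<in> L_beta \<beta>"
    using N by (simp add: L_beta_def vec_eq_iff)
  then have "x - m \<in> L"
    using L(3) z by (metis image_subset_iff)
  then show ?thesis
    using sublattice_add[OF L(1) _ m(1)] by fastforce
qed

section \<open>Evaluation\<close>

text \<open>
  Evaluation happens in the algebraic closure of \<open>\<bbbK>\<close>.  For points of the torus over the coefficient
  field all values come from that field, and vanishing can be tested there because the embedding
  is injective.
\<close>

locale coefficient_embedding =
  fixes \<iota> :: "'f::field \<Rightarrow> 'k::field"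
  assumes embedding: "field_embedding \<iota>"
begin

definition embed :: "'f \<Rightarrow> 'k alg_closure" where
  "embed x = to_ac (\<iota> x)"

lemma embed_add: "embed (x + y) = embed x + embed y" and embed_mult: "embed (x * y) = embed x * embed y" and embed_1 [simp]: "embed 1 = 1"
  using embedding by (simp_all add: embed_def field_embedding_def)

lemma embed_0 [simp]: "embed 0 = 0"
  using embed_add[of 0 0] by (simp only: add_0_left add_cancel_right_right)

lemma embed_eq_0_iff [simp]: "embed x = 0 \<longleftrightarrow> x = 0"
proof
  assume "embed x = 0"
  then have "embed (x * inverse x) = 0"
    by (simp add: embed_mult)
  then show "x = 0"
    by (cases "x = 0") auto
qed simp

lemma embed_sum: "embed (sum f A) = (\<Sum>a\<in>A. embed (f a))"
  by (induction A rule: infinite_finite_induct) (simp_all add: embed_add)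

lemma embed_prod: "embed (prod f A) = (\<Prod>a\<in>A. embed (f a))"
  by (induction A rule: infinite_finite_induct) (simp_all add: embed_mult)

lemma embed_power: "embed (x ^ n) = embed x ^ n"
  by (induction n) (simp_all add: embed_mult)

lemma embed_inverse: "embed (inverse x) = inverse (embed x)"
proof (cases "x = 0")
  case False
  then have "embed x * embed (inverse x) = 1"
    by (simp add: embed_mult[symmetric])
  then show ?thesis
    by (simp add: inverse_unique)
qed simp

lemma embed_powi: "embed (x powi n) = embed x powi n"
  by (simp add: power_int_def embed_power embed_inverse)

definition embed_point :: "'f ^ 'r \<Rightarrow> 'k alg_closure ^ 'r" where
  "embed_point P = (\<chi> j. embed (P $ j))"

lemma laurent_embed_point: "laurent (embed_point P) m = embed (laurent P m)"
  by (simp add: laurent_def embed_point_def embed_prod embed_powi)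

lemma embed_point_torus: "P \<in> torus \<Longrightarrow> embed_point P \<in> torus"
  by (simp add: torus_def embed_point_def)

lemma embed_point_rational: "embed_point P \<in> rational_points"
  by (simp add: rational_points_def embed_point_def embed_def)

lemma eval_at_eq_sum:
  assumes "finite A" "Poly_Mapping.keys F \<subseteq> A"
  shows "eval_at \<iota> P F = (\<Sum>a\<in>A. embed (Poly_Mapping.lookup F a) * laurent P (exponent a))"
  unfolding eval_at_def laurent_def exponent_def embed_def[symmetric]
  by (simp, rule sum.mono_neutral_left) (use assms in \<open>auto simp: in_keys_iff\<close>)

lemma eval_at_embed_point:
  "eval_at \<iota> (embed_point P) F =
    embed (\<Sum>a\<in>Poly_Mapping.keys F. Poly_Mapping.lookup F a * laurent P (exponent a))"
  by (simp add: eval_at_eq_sum[OF finite_keys order.refl] laurent_embed_point embed_sum embed_mult)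

lemma eval_at_0 [simp]: "eval_at \<iota> P 0 = 0"
  by (simp add: eval_at_def)

lemma eval_at_add: "eval_at \<iota> P (F + G) = eval_at \<iota> P F + eval_at \<iota> P G"
proof -
  let ?A = "Poly_Mapping.keys F \<union> Poly_Mapping.keys G"
  show ?thesis
    using Poly_Mapping.keys_add[of F G]
    by (simp add: eval_at_eq_sum[of ?A] lookup_add embed_add distrib_right sum.distrib)
qed

lemma eval_at_sum: "eval_at \<iota> P (sum f A) = (\<Sum>a\<in>A. eval_at \<iota> P (f a))"
  by (induction A rule: infinite_finite_induct) (simp_all add: eval_at_add)

lemma eval_at_single: "eval_at \<iota> P (Poly_Mapping.single a c) = embed c * laurent P (exponent a)"
  by (simp add: eval_at_eq_sum[of "{a}"])

lemma laurent_exponent_add: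
  "laurent P (exponent (a + b)) = laurent P (exponent a) * laurent P (exponent b)"
  by (simp add: laurent_def exponent_def lookup_add power_add prod.distrib flip: of_nat_add)

lemma eval_at_mult: "eval_at \<iota> P (F * G) = eval_at \<iota> P F * eval_at \<iota> P G"
proof -
  let ?s = "\<lambda>F a. Poly_Mapping.single a (Poly_Mapping.lookup F a)"
  have "F * G = (\<Sum>a\<in>Poly_Mapping.keys F. ?s F a) * (\<Sum>b\<in>Poly_Mapping.keys G. ?s G b)"
    by (simp add: cox_ring_expand[symmetric])
  then have "eval_at \<iota> P (F * G) =
      (\<Sum>a\<in>Poly_Mapping.keys F. \<Sum>b\<in>Poly_Mapping.keys G. eval_at \<iota> P (?s F a * ?s G b))"
    by (simp add: sum_product eval_at_sum)
  also have "\<dots> = eval_at \<iota> P F * eval_at \<iota> P G"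
    by (simp add: mult_single eval_at_single embed_mult laurent_exponent_add sum_product mult_ac
        eval_at_eq_sum[of "Poly_Mapping.keys F" F] eval_at_eq_sum[of "Poly_Mapping.keys G" G])
  finally show ?thesis .
qed

lemma eval_at_binomial:
  assumes "P \<in> torus" "laurent P m = 1"
  shows "eval_at \<iota> P (pos_monom m - neg_monom m) = 0"
proof -
  have "laurent P (exponent (pos_exponent m)) = laurent P (exponent (pos_exponent (- m)))"
    using assms laurent_diff[OF assms(1), of "exponent (pos_exponent m)"
        "exponent (pos_exponent (- m))"] laurent_nonzero[OF assms(1)]
    by (simp add: exponent_pos_diff)
  moreover have "eval_at \<iota> P (pos_monom m - neg_monom m) + eval_at \<iota> P (neg_monom m)
      = eval_at \<iota> P (pos_monom m)"
    by (simp flip: eval_at_add)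
  ultimately show ?thesis
    by (simp add: pos_monom_eq neg_monom_eq eval_at_single)
qed

lemma lattice_ideal_vanishes:
  assumes "P \<in> torus" "\<And>m. m \<in> L \<Longrightarrow> laurent P m = 1" "F \<in> lattice_ideal L"
  shows "eval_at \<iota> P F = 0"
proof -
  obtain T c where "T \<subseteq> (\<lambda>m. pos_monom m - neg_monom m) ` L" "F = (\<Sum>a\<in>T. c a * a)"
    using assms(3) by (auto simp: lattice_ideal_def ideal_gen_explicit)
  moreover from this have "eval_at \<iota> P a = 0" if "a \<in> T" for a
    using that assms(1,2) eval_at_binomial by blast
  ultimately show ?thesis
    by (simp add: eval_at_sum eval_at_mult)
qed

lemma torus_not_in_irrelevant_zero_set:
  assumes "P \<in> torus" "\<Sigma> \<noteq> {}"
  shows "P \<notin> affine_zero_set \<iota> (irrelevant_ideal \<Sigma> \<phi>)"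
proof -
  obtain \<sigma> where \<sigma>: "\<sigma> \<in> \<Sigma>"
    using assms(2) by blast
  let ?F = "\<Prod>i\<in>{i. \<not> ray \<phi> i \<subseteq> \<sigma>}. var i"
  have "?F \<in> irrelevant_ideal \<Sigma> \<phi>"
    unfolding irrelevant_ideal_def using \<sigma> by (intro ideal_gen_base) blast
  moreover have "eval_at \<iota> P ?F \<noteq> 0"
    using laurent_nonzero[OF assms(1)] by (simp add: var_def prod_monomial eval_at_single)
  ultimately show ?thesis
    unfolding affine_zero_set_def by blast
qed

text \<open>
  Every point \<open>g P\<close> of the orbit has nonzero coordinates and satisfies
  \<open>(g P)\<^sup>m = g\<^sup>m P\<^sup>m = 1\<close> for \<open>m \<in> L\<close>, so all of the lattice ideal vanishes there, not only
  its homogeneous elements.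
\<close>

lemma torus_orbit_in_toric_zero_set:
  assumes "\<Sigma> \<noteq> {}" "L \<subseteq> L_beta \<beta>" "P \<in> torus" "\<And>m. m \<in> L \<Longrightarrow> laurent P m = 1"
  shows "G_orbit \<beta> (embed_point P) \<in> toric_zero_set \<iota> \<Sigma> \<phi> \<beta> (lattice_ideal L)"
proof -
  let ?P = "embed_point P"
  have "G_orbit \<beta> ?P \<in> toric_points \<iota> \<Sigma> \<phi> \<beta>"
    unfolding toric_points_def
    using torus_not_in_irrelevant_zero_set embed_point_torus embed_point_rational assms(1,3)
    by blast
  moreover have "eval_at \<iota> Q F = 0" if F: "F \<in> lattice_ideal L" and Q: "Q \<in> G_orbit \<beta> ?P" for F Q
  proof -
    obtain g where g: "g \<in> group_G \<beta>" "Q = (\<chi> j. g $ j * ?P $ j)"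
      using Q by (auto simp: G_orbit_def)
    have "Q \<in> torus"
      using g embed_point_torus[OF assms(3)] by (auto simp: torus_def group_G_def)
    moreover have "laurent Q m = 1" if "m \<in> L" for m
    proof -
      have "laurent g m = 1"
        using g(1) assms(2) that by (auto simp: group_G_def laurent_def)
      then show ?thesis
        using assms(4)[OF that] by (simp add: g(2) laurent_mult_point laurent_embed_point)
    qed
    ultimately show ?thesis
      using F lattice_ideal_vanishes by blast
  qed
  ultimately show ?thesis
    by (auto simp: toric_zero_set_def vanishes_at_def)
qed

end

lemma point_in_G_orbit: "P \<in> G_orbit \<beta> P"
  unfolding G_orbit_def
  by (rule image_eqI[of _ _ "\<chi> j. 1"]) (auto simp: group_G_def vec_eq_iff)

section \<open>The vanishing ideal of a lattice subvariety\<close>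

text \<open>
  The character sums control coefficients only modulo \<open>L + (q - 1) \<int>\<^sup>r\<close>.  Homogeneity is what
  makes these classes agree with the classes modulo \<open>L\<close> on the exponents of \<open>F\<close>.
\<close>

lemma homogeneous_vanishing_in_lattice_ideal:
  fixes F :: "('r::finite, 'f::{field,finite}) cox_ring" and L :: "(int ^ 'r) set"
    and \<beta> :: "int ^ 'r ^ 'd"
  assumes hom: "homogeneous \<beta> F"
    and L: "sublattice L" "L \<subseteq> L_beta \<beta>" "(\<lambda>m. (int CARD('f) - 1) *s m) ` L_beta \<beta> \<subseteq> L"
    and vanish: "\<And>P. P \<in> torus \<Longrightarrow> (\<And>m. m \<in> L \<Longrightarrow> laurent P m = 1) \<Longrightarrow>
      (\<Sum>a\<in>Poly_Mapping.keys F. Poly_Mapping.lookup F a * laurent P (exponent a)) = 0"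
  shows "F \<in> lattice_ideal L"
proof (rule in_lattice_ideal_if_class_sums_eq_0[OF L(1)])
  let ?N = "int CARD('f) - 1" and ?K = "Poly_Mapping.keys F"
  fix b
  show "(\<Sum>a | a \<in> ?K \<and> exponent a - exponent b \<in> L. Poly_Mapping.lookup F a) = 0"
  (* The exponent b is arbitrary; an exponent a0 of F in its class shows that b has the degree of F. *)
  proof (cases "\<exists>a0\<in>?K. exponent a0 - exponent b \<in> L")
    case True
    then obtain a0 where a0: "a0 \<in> ?K" "exponent a0 - exponent b \<in> L"
      by blast
    have "exponent a - exponent b \<in> L \<longleftrightarrow> reduce ?N (exponent b - exponent a) \<in> reduce ?N ` L"
      if a: "a \<in> ?K" for a
    proof
      assume "exponent a - exponent b \<in> L"
      then show "reduce ?N (exponent b - exponent a) \<in> reduce ?N ` L"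
        using sublattice_uminus[OF L(1)] by fastforce
    next
      assume red: "reduce ?N (exponent b - exponent a) \<in> reduce ?N ` L"
      have "monomial_degree \<beta> a0 = monomial_degree \<beta> a"
        using hom a a0(1) by (auto simp: homogeneous_def)
      moreover have "monomial_degree \<beta> a0 = monomial_degree \<beta> b"
        using a0(2) L(2) by (auto simp: monomial_degree_eq_iff)
      ultimately have "exponent b - exponent a \<in> L_beta \<beta>"
        by (simp flip: monomial_degree_eq_iff)
      moreover have "?N \<noteq> 0"
        using card_field_gt_1[where 'f = 'f] by simp
      ultimately have "exponent b - exponent a \<in> L"
        using saturated_sublattice L red by blast
      then show "exponent a - exponent b \<in> L"
        using sublattice_uminus[OF L(1)] by fastforce
    qed
    then have "{a \<in> ?K. exponent a - exponent b \<in> L} =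
        {a \<in> ?K. reduce ?N (exponent b - exponent a) \<in> reduce ?N ` L}"
      by blast
    then show ?thesis
      using lattice_class_coeff_sum_eq_0[OF finite_keys L(1) vanish, of "exponent b"] by simp
  next
    case False
    then have "{a \<in> ?K. exponent a - exponent b \<in> L} = {}"
      by blast
    then show ?thesis
      by (simp only: sum.empty)
  qed
qed

theorem theorem5p2:
  fixes \<iota> :: "'f::{field,finite} \<Rightarrow> 'k::field"
    and \<Sigma> :: "(real ^ 'n) set set"
    and \<phi> :: "int ^ 'n ^ 'r"
    and \<beta> :: "int ^ 'r ^ 'd"
    and L :: "(int ^ 'r) set"
  assumes "field_embedding \<iota>"
    and "complete_fan \<Sigma>" and "simplicial_fan \<Sigma>"
    and "primitive_ray_generators \<Sigma> \<phi>"
    and "CARD('d) = CARD('r) - CARD('n)"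
    and "short_exact \<phi> \<beta>"
    and "sublattice L"
    and "(\<lambda>m. (int CARD('f) - 1) *s m) ` L_beta \<beta> \<subseteq> L"
    and "L \<subseteq> L_beta \<beta>"
  shows "vanishing_ideal \<iota> \<beta>
           (toric_zero_set \<iota> \<Sigma> \<phi> \<beta> (lattice_ideal L :: ('r, 'f) cox_ring set))
         = lattice_ideal L"
proof -
  interpret coefficient_embedding \<iota>
    by unfold_locales fact
  let ?I = "lattice_ideal L :: ('r, 'f) cox_ring set"
  let ?V = "toric_zero_set \<iota> \<Sigma> \<phi> \<beta> ?I"
  have "\<Sigma> \<noteq> {}"
    using assms(2) by (auto simp: complete_fan_def)
  have "F \<in> ?I" if F: "homogeneous \<beta> F" "\<forall>p\<in>?V. vanishes_at \<iota> F p" for F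
  proof (rule homogeneous_vanishing_in_lattice_ideal[OF F(1) assms(7,9,8)])
    fix P :: "'f ^ 'r"
    assume "P \<in> torus" "\<And>m. m \<in> L \<Longrightarrow> laurent P m = 1"
    then have "G_orbit \<beta> (embed_point P) \<in> ?V"
      using torus_orbit_in_toric_zero_set \<open>\<Sigma> \<noteq> {}\<close> assms(9) by blast
    then have "eval_at \<iota> (embed_point P) F = 0"
      using F(2) point_in_G_orbit by (auto simp: vanishes_at_def)
    then show "(\<Sum>a\<in>Poly_Mapping.keys F. Poly_Mapping.lookup F a * laurent P (exponent a)) = 0"
      by (simp add: eval_at_embed_point)
  qed
  then have "vanishing_ideal \<iota> \<beta> ?V \<subseteq> ?I"
    unfolding vanishing_ideal_def lattice_ideal_def[of L]
    by (intro ideal_gen_subset) (auto simp: lattice_ideal_def)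
  moreover have "?I \<subseteq> vanishing_ideal \<iota> \<beta> ?V"
    unfolding vanishing_ideal_def lattice_ideal_def[of L]
  proof (intro ideal_gen_subset image_subsetI ideal_gen_base CollectI conjI ballI)
    fix m assume m: "m \<in> L"
    show hom: "homogeneous \<beta> (pos_monom m - neg_monom m :: ('r, 'f) cox_ring)"
      using m assms(9) by (blast intro: homogeneous_binomial)
    have "pos_monom m - neg_monom m \<in> ?I"
      using m unfolding lattice_ideal_def by (intro ideal_gen_base) blast
    then show "vanishes_at \<iota> (pos_monom m - neg_monom m) p"
      if "p \<in> toric_zero_set \<iota> \<Sigma> \<phi> \<beta>
        (ideal_gen ((\<lambda>m. pos_monom m - neg_monom m) ` L) :: ('r, 'f) cox_ring set)" for p
      using that hom by (auto simp: toric_zero_set_def lattice_ideal_def)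
  qed
  ultimately show ?thesis
    by blast
qed

end
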